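(* Let $R$ be a ring with unit $1$ and let $a\in R$ be such that the group inverse $a^\#$ exists. Let $\delta a\in R$ and $\bar a=a+\delta a$, and assume that $1+a^\#\delta a$ is invertible in $R$. Put $$a^\pi=1-a^\#a,\qquad \Phi(a)=1+\delta a\,a^\pi\,\delta a\,\big[(1+a^\#\delta a)^{-1}a^\#\big]^2,\qquad C(a)=a^\pi\,\delta a\,(1+a^\#\delta a)^{-1}a^\#.$$ Suppose that $\Phi(a)$ is invertible in $R$ and that $\bar a R\cap(1-aa^\#)R=\{0\}$. Put $D(a)=(1+a^\#\delta a)^{-1}a^\#\Phi(a)^{-1}$. Then $\bar a^\#$ exists and $$\bar a^\#=(1+C(a))\big(D(a)+D(a)^2\,\delta a\,a^\pi\big)(1-C(a)).$$
   Context: For $x$ in a ring $R$ with unit (not necessarily commutative), the group inverse of $x$, denoted $x^\#$, is the (unique, if it exists) element $y\in R$ with $xyx=x$, $yxy=y$, $xy=yx$. Here $\delta a$ denotes a single element of $R$ (the perturbation of $a$), not a product. For $x\in R$, $xR=\{xr: r\in R\}$. *)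

theory Defs
  imports Main
begin

text \<open>
  Unital associative rings are elements of the sort \<open>{ring, monoid_mult}\<close>. Unlike
  class \<open>ring_1\<close>, this does not impose \<open>0 \<noteq> 1\<close>, so the zero ring is included.
  The operations \<open>mult_inverse\<close> and \<open>group_inverse\<close> are unspecified
  when the inverse in question does not exist.
\<close>

definition mult_invertible :: "'a::{ring, monoid_mult} \<Rightarrow> bool" where
  "mult_invertible u \<longleftrightarrow> (\<exists>v. u * v = 1 \<and> v * u = 1)"

definition mult_inverse :: "'a::{ring, monoid_mult} \<Rightarrow> 'a" where
  "mult_inverse u = (THE v. u * v = 1 \<and> v * u = 1)"

definition is_group_inverse :: "'a::{ring, monoid_mult} \<Rightarrow> 'a \<Rightarrow> bool" where
  "is_group_inverse x y \<longleftrightarrow> x * y * x = x \<and> y * x * y = y \<and> x * y = y * x"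

definition group_invertible :: "'a::{ring, monoid_mult} \<Rightarrow> bool" where
  "group_invertible x \<longleftrightarrow> (\<exists>y. is_group_inverse x y)"

definition group_inverse :: "'a::{ring, monoid_mult} \<Rightarrow> 'a" where
  "group_inverse x = (THE y. is_group_inverse x y)"

definition right_multiples :: "'a::{ring, monoid_mult} \<Rightarrow> 'a set" where
  "right_multiples x = {x * r | r. True}"

lemma mult_inverse_eqI:
  fixes u v :: "'a::{ring, monoid_mult}"
  assumes "u * v = 1" and "v * u = 1"
  shows "mult_inverse u = v"
  unfolding mult_inverse_def
proof (rule the_equality)
  fix w assume w: "u * w = 1 \<and> w * u = 1"
  have "w = w * (u * v)" using assms by simp
  also have "\<dots> = v" using w by (simp flip: mult.assoc)
  finally show "w = v" .
qed (use assms in simp)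

lemma is_group_inverse_unique:
  fixes x y z :: "'a::{ring, monoid_mult}"
  assumes y: "is_group_inverse x y" and z: "is_group_inverse x z"
  shows "y = z"
proof -
  note Y = y[unfolded is_group_inverse_def] and Z = z[unfolded is_group_inverse_def]
  have xy: "x * y = x * z"
  proof -
    have "x * y = (x * z * x) * y" using Z by metis
    also have "\<dots> = (x * z) * (x * y)" by (simp only: mult.assoc)
    also have "\<dots> = (z * x) * (y * x)" using Y Z by metis
    also have "\<dots> = z * (x * y * x)" by (simp only: mult.assoc)
    also have "\<dots> = x * z" using Y Z by metis
    finally show ?thesis .
  qed
  have "y = y * (x * y)" using Y by (metis mult.assoc)
  also have "\<dots> = y * (x * z)" by (simp only: xy)
  also have "\<dots> = (y * x) * z" by (simp only: mult.assoc)
  also have "\<dots> = (z * x) * z" using xy Y Z by metis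
  also have "\<dots> = z" using Z by metis
  finally show ?thesis .
qed

lemma group_inverse_eqI: "is_group_inverse x y \<Longrightarrow> group_inverse x = y"
  unfolding group_inverse_def by (blast intro: is_group_inverse_unique)

text \<open>
  In the following, \<open>da\<close> is the perturbation of \<open>a\<close> (a single ring element).
  \<open>spectral_idem a\<close> is written \<open>a\<^sup>\<pi>\<close>, and \<open>pert_\<Phi> a da\<close>, \<open>pert_C a da\<close>, \<open>pert_D a da\<close>
  are written \<open>\<Phi>(a)\<close>, \<open>C(a)\<close>, \<open>D(a)\<close>, with the dependence on \<open>da\<close> left implicit.
\<close>

definition spectral_idem :: "'a::{ring, monoid_mult} \<Rightarrow> 'a" where
  "spectral_idem a = 1 - group_inverse a * a"

definition pert_\<Phi> :: "'a::{ring, monoid_mult} \<Rightarrow> 'a \<Rightarrow> 'a" where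
  "pert_\<Phi> a da =
     1 + da * spectral_idem a * da *
         (mult_inverse (1 + group_inverse a * da) * group_inverse a)\<^sup>2"

definition pert_C :: "'a::{ring, monoid_mult} \<Rightarrow> 'a \<Rightarrow> 'a" where
  "pert_C a da =
     spectral_idem a * da * mult_inverse (1 + group_inverse a * da) * group_inverse a"

definition pert_D :: "'a::{ring, monoid_mult} \<Rightarrow> 'a \<Rightarrow> 'a" where
  "pert_D a da =
     mult_inverse (1 + group_inverse a * da) * group_inverse a * mult_inverse (pert_\<Phi> a da)"

end

theory Submission
  imports Defs
begin

text \<open>
  Put \<open>e = a a\<^sup>#\<close> and \<open>p = 1 - e\<close>, and write elements as two by two matrices with respect to
  \<open>1 = e + p\<close>. Then \<open>H = (1 + a\<^sup># \<delta>a)\<^sup>-\<^sup>1 a\<^sup>#\<close> is the inverse of the corner \<open>e b e\<close> of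
  \<open>b = a + \<delta>a\<close> in the ring \<open>eRe\<close>. The condition \<open>bR \<inter> pR = {0}\<close> says that the
  Schur complement of this corner, which is \<open>b (p - H \<delta>a p)\<close>, vanishes. Hence
  conjugation by \<open>1 + C\<close> removes the lower row of \<open>b\<close>: \<open>(1 - C) b (1 + C) = X + Y\<close>
  with \<open>X = e b e + e \<delta>a C\<close> in \<open>eRe\<close> and \<open>Y = e \<delta>a p\<close>. Since \<open>X H = e \<Phi>\<close>, the element
  \<open>D = H \<Phi>\<^sup>-\<^sup>1\<close> is the inverse of \<open>X\<close> in \<open>eRe\<close>, so \<open>X + Y\<close> has the group inverse
  \<open>D + D\<^sup>2 Y\<close>.
\<close>

lemma mult_inverse:
  fixes u :: "'a::{ring, monoid_mult}"
  assumes "mult_invertible u"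
  shows mult_inverse_right: "u * mult_inverse u = 1"
    and mult_inverse_left: "mult_inverse u * u = 1"
proof -
  obtain v where v: "u * v = 1" "v * u = 1"
    using assms unfolding mult_invertible_def by blast
  then have "mult_inverse u = v" by (rule mult_inverse_eqI)
  with v show "u * mult_inverse u = 1" and "mult_inverse u * u = 1" by simp_all
qed

lemma is_group_inverse_group_inverse:
  "group_invertible x \<Longrightarrow> is_group_inverse x (group_inverse x)"
  unfolding group_invertible_def using group_inverse_eqI by blast

text \<open>Since \<open>v * u = 1\<close> cancels between adjacent factors,
  \<open>x \<mapsto> u * x * v\<close> is multiplicative, so it carries the three defining equations
  over.\<close>

lemma is_group_inverse_conjugate:
  fixes m n u v :: "'a::{ring, monoid_mult}"
  assumes "is_group_inverse m n" and "v * u = 1"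
  shows "is_group_inverse (u * m * v) (u * n * v)"
proof -
  have conj_mult: "(u * x * v) * (u * y * v) = u * (x * y) * v" for x y
  proof -
    have "(u * x * v) * (u * y * v) = u * x * (v * u) * y * v"
      by (simp only: mult.assoc)
    with assms(2) show ?thesis by (simp add: mult.assoc)
  qed
  show ?thesis
    using assms(1) unfolding is_group_inverse_def conj_mult by metis
qed

text \<open>Here \<open>d\<close> inverts \<open>x\<close> in the corner of \<open>e\<close>, while
  \<open>y\<close> annihilates \<open>x\<close>, \<open>d\<close> and itself because
  \<open>y * e = 0\<close>. The correction \<open>d * d * y\<close> makes the two products agree:
  both are \<open>e + d * y\<close>, a left identity for \<open>x + y\<close> and for the
  candidate.\<close>

lemma is_group_inverse_upper_triangular:
  fixes e x y d :: "'a::{ring, monoid_mult}"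
  assumes "e * x = x" "e * y = y" "y * e = 0"
    and "e * d = d" "d * e = d" "x * d = e" "d * x = e"
  shows "is_group_inverse (x + y) (d + d * d * y)"
proof -
  have zero: "y * x = 0" "y * d = 0"
    by (metis assms(1,3) mult.assoc mult_zero_left) (metis assms(3,4) mult.assoc mult_zero_left)
  have yz: "y * (d * w) = 0" for w
    by (simp flip: mult.assoc add: zero)
  have xd: "x * (d * w) = e * w" "d * (x * w) = e * w" "e * (d * w) = d * w" for w
    by (simp_all flip: mult.assoc add: assms)
  have l: "(x + y) * (d + d * d * y) = e + d * y"
    by (simp add: algebra_simps zero yz xd assms)
  have "d * d * y * y = d * d * (y * e) * y"
    using assms(2) by (simp add: mult.assoc)
  then have ddyy: "d * d * y * y = 0" using assms(3) by simp
  have "d * y * y = d * (y * e) * y"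
    using assms(2) by (simp add: mult.assoc)
  then have dyy: "d * (y * y) = 0" using assms(3) by (simp add: mult.assoc)
  have r: "(d + d * d * y) * (x + y) = e + d * y"
    by (simp add: algebra_simps zero dyy assms)
  have "(e + d * y) * (x + y) = x + y" "(e + d * y) * (d + d * d * y) = d + d * d * y"
    by (simp_all add: algebra_simps zero yz xd dyy assms)
  with l r show ?thesis unfolding is_group_inverse_def
    by (simp add: mult.assoc)
qed

theorem theorem3p2:
  fixes a da :: "'a::{ring, monoid_mult}"
  assumes "group_invertible a"
    and "mult_invertible (1 + group_inverse a * da)"
    and "mult_invertible (pert_\<Phi> a da)"
    and "right_multiples (a + da) \<inter> right_multiples (1 - a * group_inverse a) = {0}"
  shows "group_invertible (a + da) \<and>
    group_inverse (a + da) =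
      (1 + pert_C a da) *
      (pert_D a da + (pert_D a da)\<^sup>2 * da * spectral_idem a) *
      (1 - pert_C a da)"
proof -
  define g where "g = group_inverse a"
  define e where "e = a * g"
  define p where "p = 1 - e"
  define b where "b = a + da"
  define T where "T = mult_inverse (1 + g * da)"
  define H where "H = T * g"
  define C where "C = p * da * H"
  define \<Phi> where "\<Phi> = 1 + da * C * H"
  define \<Psi> where "\<Psi> = mult_inverse \<Phi>"
  define D where "D = H * \<Psi>"
  define X where "X = e * b * e + e * da * C"
  define Y where "Y = e * da * p"

  have "is_group_inverse a g"
    unfolding g_def using assms(1) by (rule is_group_inverse_group_inverse)
  then have aga: "a * g * a = a" and gag: "g * a * g = g" and comm: "a * g = g * a"
    unfolding is_group_inverse_def by auto
  have ga: "g * a = e" by (simp add: e_def comm)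
  have ea: "e * a = a" by (simp add: e_def aga)
  have ae: "a * e = a" by (metis aga ga mult.assoc)
  have eg: "e * g = g" by (metis ga gag)
  have ge: "g * e = g" by (metis e_def gag mult.assoc)
  have ee: "e * e = e" by (metis e_def ea mult.assoc)
  have ep: "e * p = 0" and pe: "p * e = 0"
    and ap: "a * p = 0" and pa: "p * a = 0"
    by (simp_all add: p_def algebra_simps ee ae ea)

  have spectral: "spectral_idem a = p"
    unfolding spectral_idem_def p_def g_def[symmetric] ga ..
  have pertC: "pert_C a da = C"
    unfolding pert_C_def C_def H_def T_def g_def[symmetric] spectral by (simp add: mult.assoc)
  have pertPhi: "pert_\<Phi> a da = \<Phi>"
    unfolding pert_\<Phi>_def \<Phi>_def C_def H_def T_def g_def[symmetric] spectral
    by (simp add: mult.assoc power2_eq_square)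
  have pertD: "pert_D a da = D"
    unfolding pert_D_def pertPhi D_def \<Psi>_def H_def T_def g_def[symmetric] ..

  have T1: "(1 + g * da) * T = 1" and T2: "T * (1 + g * da) = 1"
    using mult_inverse[OF assms(2)] by (simp_all add: T_def g_def)
  have P1: "\<Phi> * \<Psi> = 1" and P2: "\<Psi> * \<Phi> = 1"
    using mult_inverse[OF assms(3)] by (simp_all add: \<Psi>_def pertPhi)

  have He: "H * e = H" by (simp add: H_def mult.assoc ge)
  \<comment> \<open>The right inverse law gives \<open>T = 1 - g * da * T\<close>, so
    \<open>H = T * g\<close> is also a right multiple of \<open>g\<close>.\<close>
  have eH: "e * H = H"
  proof -
    have "H = (T + g * da * T - g * da * T) * g" by (simp add: H_def)
    also have "T + g * da * T = 1" using T1 by (simp add: algebra_simps)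
    finally have "H = g * (1 - da * T * g)" by (simp add: algebra_simps)
    then show ?thesis by (metis eg mult.assoc)
  qed
  have Hp: "H * p = 0" by (simp add: p_def algebra_simps He)
  \<comment> \<open>Next to \<open>e\<close>, the term \<open>g * a = e\<close> may be replaced by
    \<open>1\<close>, which turns \<open>g * b\<close> into \<open>1 + g * da\<close>.\<close>
  have Hbe: "H * b * e = e"
  proof -
    have "H * b * e = T * (1 + g * da) * e"
      by (simp add: H_def b_def algebra_simps ga ee)
    then show ?thesis by (simp add: T2)
  qed
  \<comment> \<open>Rests on the factorization \<open>e * b = a * (1 + g * da)\<close>.\<close>
  have ebH: "e * b * H = e"
  proof -
    have "e * b * T = a * ((1 + g * da) * T)"
      by (simp add: b_def algebra_simps e_def aga) (simp flip: mult.assoc add: aga)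
    then show ?thesis unfolding T1 H_def by (simp add: e_def flip: mult.assoc)
  qed

  have Ce: "C * e = C" by (simp add: C_def mult.assoc He)
  have eC: "e * C = 0" by (simp add: C_def ep flip: mult.assoc)
  have aC: "a * C = 0" by (simp add: C_def ap flip: mult.assoc)
  have CC: "C * C = 0" by (metis Ce eC mult.assoc mult_zero_right)

  \<comment> \<open>The element visibly lies in \<open>bR\<close>. Its upper row vanishes by
    \<open>ebH\<close>, so it also lies in \<open>pR\<close>.\<close>
  have schur: "b * (p - H * da * p) = 0"
  proof -
    let ?z = "b * (p - H * da * p)"
    have bp: "b * p = da * p" by (simp add: b_def algebra_simps ap)
    have "e * ?z = e * (b * p) - (e * b * H) * da * p"
      by (simp add: algebra_simps)
    also have "\<dots> = 0" by (simp only: bp ebH) (simp add: mult.assoc)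
    finally have "?z = p * ?z" by (simp add: p_def left_diff_distrib)
    then have "?z \<in> right_multiples (1 - a * group_inverse a)"
      unfolding right_multiples_def p_def e_def g_def by blast
    moreover have "?z \<in> right_multiples (a + da)"
      unfolding right_multiples_def b_def by blast
    ultimately show ?thesis using assms(4) by blast
  qed
  have pb: "p * b = p * da" by (simp add: b_def algebra_simps pa)
  have "p * da * p = C * da * p"
  proof -
    have "0 = p * (b * (p - H * da * p))" by (simp add: schur)
    also have "\<dots> = (p * b) * p - (p * b) * H * da * p" by (simp add: algebra_simps)
    also have "\<dots> = p * da * p - C * da * p" by (simp add: pb C_def)
    finally show ?thesis by simp
  qed
  moreover have "C * b * p = C * da * p"
    by (simp add: b_def algebra_simps ap)
  moreover have "C * b * e = p * da * e"
    by (metis C_def Hbe mult.assoc)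
  \<comment> \<open>The columns are compared separately: on \<open>e\<close> the equation comes from
    \<open>Hbe\<close>, on \<open>p\<close> from the lower row of \<open>schur\<close>.\<close>
  ultimately have "C * b * (e + p) = p * da * (e + p)"
    by (simp only: distrib_left)
  then have Cb: "C * b = p * b" by (simp add: p_def pb[unfolded p_def])

  have conj: "(1 - C) * b * (1 + C) = X + Y"
  proof -
    have "(1 - C) * b = b - p * b" by (simp add: left_diff_distrib Cb)
    also have "\<dots> = e * b" by (simp add: p_def left_diff_distrib)
    finally have "(1 - C) * b * (1 + C) = e * b * ((e + p) + C)" by (simp add: p_def)
    also have "\<dots> = X + Y"
      by (simp add: X_def Y_def b_def distrib_left distrib_right mult.assoc ap aC)
    finally show ?thesis .
  qed
  have CC1: "(1 + C) * (1 - C) = 1" and CC2: "(1 - C) * (1 + C) = 1"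
    by (simp_all add: algebra_simps CC)
  have "b = ((1 + C) * (1 - C)) * b * ((1 + C) * (1 - C))" by (simp add: CC1)
  also have "\<dots> = (1 + C) * ((1 - C) * b * (1 + C)) * (1 - C)" by (simp only: mult.assoc)
  finally have b: "b = (1 + C) * (X + Y) * (1 - C)" unfolding conj .

  have XH: "X * H = e * \<Phi>"
  proof -
    have "X * H = e * b * (e * H) + e * da * C * H" by (simp add: X_def algebra_simps)
    then show ?thesis unfolding eH ebH by (simp add: \<Phi>_def distrib_left mult.assoc)
  qed
  have XD: "X * D = e"
  proof -
    have "X * D = e * (\<Phi> * \<Psi>)" by (simp add: D_def XH flip: mult.assoc)
    then show ?thesis by (simp add: P1)
  qed
  \<comment> \<open>\<open>\<Psi>\<close> itself need not lie in the corner, but it fixes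
    \<open>p\<close>, which \<open>H\<close> then kills; hence \<open>D\<close> does lie
    there.\<close>
  have "\<Phi> * p = p" by (simp add: \<Phi>_def distrib_right mult.assoc Hp)
  then have "\<Psi> * p = p" by (metis P2 mult.assoc mult_1_left)
  then have Dp: "D * p = 0" by (simp add: D_def mult.assoc Hp)
  then have De: "D * e = D" by (simp add: p_def right_diff_distrib)
  have eD: "e * D = D" by (simp add: D_def eH flip: mult.assoc)
  \<comment> \<open>Inserting \<open>H * b * e = e\<close> to the right of \<open>X\<close> exposes
    the factor \<open>\<Phi>\<close> on the left, where \<open>\<Psi>\<close> from \<open>D\<close>
    cancels it.\<close>
  have DX: "D * X = e"
  proof -
    have "X = X * (H * b * e)"
      unfolding Hbe by (simp add: X_def distrib_right mult.assoc ee Ce)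
    also have "\<dots> = e * \<Phi> * b * e" by (simp add: XH flip: mult.assoc)
    finally have "D * X = (D * e) * \<Phi> * b * e" by (simp only: mult.assoc)
    also have "\<dots> = H * (\<Psi> * \<Phi>) * b * e" unfolding De by (simp only: D_def mult.assoc)
    finally show ?thesis by (simp add: P2 Hbe)
  qed

  have "e * X = X" "e * Y = Y"
    by (simp_all add: X_def Y_def distrib_left ee flip: mult.assoc)
  moreover have "Y * e = 0" by (simp add: Y_def mult.assoc pe)
  ultimately have "is_group_inverse (X + Y) (D + D * D * Y)"
    using eD De XD DX by (rule is_group_inverse_upper_triangular)
  then have "is_group_inverse b ((1 + C) * (D + D * D * Y) * (1 - C))"
    unfolding b using CC2 by (rule is_group_inverse_conjugate)
  moreover have "D * D * Y = D\<^sup>2 * da * p"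
  proof -
    have "D * D * Y = D * (D * e) * da * p" by (simp only: Y_def mult.assoc)
    then show ?thesis by (simp add: De power2_eq_square)
  qed
  ultimately have "is_group_inverse (a + da) ((1 + C) * (D + D\<^sup>2 * da * p) * (1 - C))"
    by (simp add: b_def)
  then show ?thesis
    unfolding pertC pertD spectral group_invertible_def
    using group_inverse_eqI by blast
qed

end
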